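(* Let $\mathcal{C}$ be a (small) category. The nerve $N\mathcal{C}$ admits a duplicial structure if and only if there exist a groupoid $\mathcal{G}$ and an adjunction $I \dashv R$ with left adjoint $I\colon \mathcal{G}\to\mathcal{C}$ and right adjoint $R\colon \mathcal{C}\to\mathcal{G}$.
   Context: The nerve $N\mathcal{C}$ is the simplicial set whose set of $n$-simplices is the set of composable $n$-tuples $A_0\xrightarrow{f_0}A_1\xrightarrow{f_1}\cdots\xrightarrow{f_{n-1}}A_n$ of morphisms of $\mathcal{C}$ (objects of $\mathcal{C}$ when $n=0$), written $(f_{n-1},\dots,f_0)$. For $0\le i\le n$, the face map $d_i$ sends it to $(f_{n-1},\dots,f_1)$ if $i=0$, to $(f_{n-1},\dots,f_if_{i-1},\dots,f_0)$ if $0<i<n$, and to $(f_{n-2},\dots,f_0)$ if $i=n$ (for $n=1$: $d_0(f_0)=A_1$, $d_1(f_0)=A_0$); the degeneracy map is $s_i(f_{n-1},\dots,f_0)=(f_{n-1},\dots,f_i,1,f_{i-1},\dots,f_0)$. A duplicial structure on a simplicial object $X$ consists of a morphism $t\colon X_n\to X_n$ for each $n\ge 0$ such that $$d_it=\begin{cases} t d_{i-1} & 1\le i\le n\\ d_n & i=0\end{cases}\ (n\ge 1),\qquad s_jt=\begin{cases} t s_{j-1} & 1\le j\le n\\ t^2s_n & j=0\end{cases}\ (n\ge 0)$$ (on $X_n$). No invertibility of $t$ is required. *)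

theory Defs
  imports Main
begin

section \<open>Categories, groupoids and adjunctions\<close>

text \<open>
  All operations are total functions; every axiom is relativised to the carriers
  \<open>Obj\<close> and \<open>Arr\<close>, and values outside them are irrelevant.  As objects and arrows form
  sets of a HOL type, every category here is small.  Composition is in the usual order:
  \<open>g \<cdot> f\<close> is first \<open>f\<close>, then \<open>g\<close>.
\<close>

record ('o, 'a) cat =
  Obj :: "'o set"
  Arr :: "'a set"
  Dom :: "'a \<Rightarrow> 'o"
  Cod :: "'a \<Rightarrow> 'o"
  Idt :: "'o \<Rightarrow> 'a"
  Cmp :: "'a \<Rightarrow> 'a \<Rightarrow> 'a"  (infixl "\<cdot>\<index>" 70)

definition hom :: "('o, 'a) cat \<Rightarrow> 'o \<Rightarrow> 'o \<Rightarrow> 'a set" where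
  "hom C A B = {f \<in> Arr C. Dom C f = A \<and> Cod C f = B}"

locale category =
  fixes C :: "('o, 'a) cat" (structure)
  assumes Dom_Obj: "f \<in> Arr C \<Longrightarrow> Dom C f \<in> Obj C"
    and Cod_Obj: "f \<in> Arr C \<Longrightarrow> Cod C f \<in> Obj C"
    and Idt_hom: "A \<in> Obj C \<Longrightarrow> Idt C A \<in> hom C A A"
    and Cmp_hom: "f \<in> hom C A B \<Longrightarrow> g \<in> hom C B D \<Longrightarrow> g \<cdot> f \<in> hom C A D"
    and Cmp_Idt_right: "f \<in> hom C A B \<Longrightarrow> f \<cdot> Idt C A = f"
    and Cmp_Idt_left: "f \<in> hom C A B \<Longrightarrow> Idt C B \<cdot> f = f"
    and Cmp_assoc: "f \<in> hom C A B \<Longrightarrow> g \<in> hom C B D \<Longrightarrow> h \<in> hom C D E \<Longrightarrow>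
      h \<cdot> (g \<cdot> f) = (h \<cdot> g) \<cdot> f"

locale groupoid = category +
  assumes invertible: "f \<in> hom C A B \<Longrightarrow>
    \<exists>g \<in> hom C B A. g \<cdot> f = Idt C A \<and> f \<cdot> g = Idt C B"

record ('o, 'a, 'p, 'b) func =
  omap :: "'o \<Rightarrow> 'p"
  amap :: "'a \<Rightarrow> 'b"

locale cat_functor = source: category C + target: category D
  for C :: "('o, 'a) cat" and D :: "('p, 'b) cat" +
  fixes F :: "('o, 'a, 'p, 'b) func"
  assumes omap_Obj: "A \<in> Obj C \<Longrightarrow> omap F A \<in> Obj D"
    and amap_hom: "f \<in> hom C A B \<Longrightarrow> amap F f \<in> hom D (omap F A) (omap F B)"
    and amap_Idt: "A \<in> Obj C \<Longrightarrow> amap F (Idt C A) = Idt D (omap F A)"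
    and amap_Cmp: "f \<in> hom C A B \<Longrightarrow> g \<in> hom C B E \<Longrightarrow>
      amap F (g \<cdot>\<^bsub>C\<^esub> f) = amap F g \<cdot>\<^bsub>D\<^esub> amap F f"

text \<open>
  \<open>L: G \<rightarrow> C\<close> is left adjoint to \<open>R: C \<rightarrow> G\<close> with unit
  \<open>\<eta>: 1 \<Rightarrow> R L\<close> and counit \<open>\<epsilon>: L R \<Rightarrow> 1\<close>.
\<close>

locale adjunction = left: cat_functor G C L + right: cat_functor C G R
  for G :: "('p, 'b) cat" and C :: "('o, 'a) cat"
    and L :: "('p, 'b, 'o, 'a) func" and R :: "('o, 'a, 'p, 'b) func" +
  fixes \<eta> :: "'p \<Rightarrow> 'b" and \<epsilon> :: "'o \<Rightarrow> 'a"
  assumes unit_hom: "X \<in> Obj G \<Longrightarrow> \<eta> X \<in> hom G X (omap R (omap L X))"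
    and unit_natural: "u \<in> hom G X Y \<Longrightarrow>
      amap R (amap L u) \<cdot>\<^bsub>G\<^esub> \<eta> X = \<eta> Y \<cdot>\<^bsub>G\<^esub> u"
    and counit_hom: "A \<in> Obj C \<Longrightarrow> \<epsilon> A \<in> hom C (omap L (omap R A)) A"
    and counit_natural: "f \<in> hom C A B \<Longrightarrow>
      f \<cdot>\<^bsub>C\<^esub> \<epsilon> A = \<epsilon> B \<cdot>\<^bsub>C\<^esub> amap L (amap R f)"
    and triangle_left: "X \<in> Obj G \<Longrightarrow>
      \<epsilon> (omap L X) \<cdot>\<^bsub>C\<^esub> amap L (\<eta> X) = Idt C (omap L X)"
    and triangle_right: "A \<in> Obj C \<Longrightarrow>
      amap R (\<epsilon> A) \<cdot>\<^bsub>G\<^esub> \<eta> (omap R A) = Idt G (omap R A)"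

definition left_adjoint ::
    "('p, 'b) cat \<Rightarrow> ('o, 'a) cat \<Rightarrow> ('p, 'b, 'o, 'a) func \<Rightarrow> ('o, 'a, 'p, 'b) func \<Rightarrow> bool" where
  "left_adjoint G C L R \<longleftrightarrow> (\<exists>\<eta> \<epsilon>. adjunction G C L R \<eta> \<epsilon>)"


section \<open>Simplicial sets and duplicial structures\<close>

text \<open>
  The first index of \<open>d\<close>, \<open>s\<close> and \<open>t\<close> is the dimension of the source:
  \<open>d n i: X n \<rightarrow> X (n - 1)\<close>, \<open>s n i: X n \<rightarrow> X (n + 1)\<close>, \<open>t n: X n \<rightarrow> X n\<close>.
\<close>

locale simplicial_set =
  fixes X :: "nat \<Rightarrow> 'x set"
    and d :: "nat \<Rightarrow> nat \<Rightarrow> 'x \<Rightarrow> 'x"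
    and s :: "nat \<Rightarrow> nat \<Rightarrow> 'x \<Rightarrow> 'x"
  assumes face_in: "x \<in> X (Suc n) \<Longrightarrow> i \<le> Suc n \<Longrightarrow> d (Suc n) i x \<in> X n"
    and degen_in: "x \<in> X n \<Longrightarrow> i \<le> n \<Longrightarrow> s n i x \<in> X (Suc n)"
    and face_face: "x \<in> X (Suc (Suc n)) \<Longrightarrow> i < j \<Longrightarrow> j \<le> Suc (Suc n) \<Longrightarrow>
      d (Suc n) i (d (Suc (Suc n)) j x) = d (Suc n) (j - 1) (d (Suc (Suc n)) i x)"
    and face_degen_less: "x \<in> X (Suc n) \<Longrightarrow> i < j \<Longrightarrow> j \<le> Suc n \<Longrightarrow>
      d (Suc (Suc n)) i (s (Suc n) j x) = s n (j - 1) (d (Suc n) i x)"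
    and face_degen_same: "x \<in> X n \<Longrightarrow> j \<le> n \<Longrightarrow> i = j \<or> i = Suc j \<Longrightarrow>
      d (Suc n) i (s n j x) = x"
    and face_degen_greater: "x \<in> X (Suc n) \<Longrightarrow> Suc j < i \<Longrightarrow> i \<le> Suc (Suc n) \<Longrightarrow>
      d (Suc (Suc n)) i (s (Suc n) j x) = s n j (d (Suc n) (i - 1) x)"
    and degen_degen: "x \<in> X n \<Longrightarrow> i \<le> j \<Longrightarrow> j \<le> n \<Longrightarrow>
      s (Suc n) i (s n j x) = s (Suc n) (Suc j) (s n i x)"

locale duplicial_structure = simplicial_set +
  fixes t :: "nat \<Rightarrow> 'a \<Rightarrow> 'a"
  assumes t_in: "x \<in> X n \<Longrightarrow> t n x \<in> X n"
    and face_t: "x \<in> X n \<Longrightarrow> 1 \<le> i \<Longrightarrow> i \<le> n \<Longrightarrow>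
      d n i (t n x) = t (n - 1) (d n (i - 1) x)"
    and face_t_0: "x \<in> X n \<Longrightarrow> 1 \<le> n \<Longrightarrow> d n 0 (t n x) = d n n x"
    and degen_t: "x \<in> X n \<Longrightarrow> 1 \<le> j \<Longrightarrow> j \<le> n \<Longrightarrow>
      s n j (t n x) = t (n + 1) (s n (j - 1) x)"
    and degen_t_0: "x \<in> X n \<Longrightarrow>
      s n 0 (t n x) = t (n + 1) (t (n + 1) (s n n x))"


section \<open>The nerve\<close>

text \<open>
  The simplex \<open>A\<^sub>0 \<rightarrow> A\<^sub>1 \<rightarrow> \<dots> \<rightarrow> A\<^sub>n\<close> given by \<open>f\<^sub>0, \<dots>, f\<^bsub>n-1\<^esub>\<close> is encoded
  as the pair \<open>(A\<^sub>0, [f\<^sub>0, \<dots>, f\<^bsub>n-1\<^esub>])\<close>: the list starts with \<open>f\<^sub>0\<close>, the reverse of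
  the written order \<open>(f\<^bsub>n-1\<^esub>, \<dots>, f\<^sub>0)\<close>.  The first component is determined by the list
  when \<open>n \<ge> 1\<close>; it makes the \<open>0\<close>-simplices the objects \<open>(A\<^sub>0, [])\<close>.
\<close>

type_synonym ('o, 'a) simplex = "'o \<times> 'a list"

definition vertex :: "('o, 'a) cat \<Rightarrow> ('o, 'a) simplex \<Rightarrow> nat \<Rightarrow> 'o" where
  "vertex C x k = (case k of 0 \<Rightarrow> fst x | Suc m \<Rightarrow> Cod C (snd x ! m))"

definition nerve :: "('o, 'a) cat \<Rightarrow> nat \<Rightarrow> ('o, 'a) simplex set" where
  "nerve C n = {x. fst x \<in> Obj C \<and> length (snd x) = n \<and>
     (\<forall>k < n. snd x ! k \<in> hom C (vertex C x k) (vertex C x (Suc k)))}"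

definition nerve_face ::
    "('o, 'a) cat \<Rightarrow> nat \<Rightarrow> nat \<Rightarrow> ('o, 'a) simplex \<Rightarrow> ('o, 'a) simplex" where
  "nerve_face C n i x =
     (let fs = snd x in
      if i = 0 then (vertex C x 1, tl fs)
      else if i < n then
        (fst x, take (i - 1) fs @ [fs ! i \<cdot>\<^bsub>C\<^esub> fs ! (i - 1)] @ drop (i + 1) fs)
      else (fst x, butlast fs))"

definition nerve_degen ::
    "('o, 'a) cat \<Rightarrow> nat \<Rightarrow> nat \<Rightarrow> ('o, 'a) simplex \<Rightarrow> ('o, 'a) simplex" where
  "nerve_degen C n i x =
     (let fs = snd x in (fst x, take i fs @ [Idt C (vertex C x i)] @ drop i fs))"

lemma nerve_iff:
  "(A, fs) \<in> nerve C n \<longleftrightarrow> A \<in> Obj C \<and> length fs = n \<and>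
     (\<forall>k < n. fs ! k \<in> Arr C \<and>
        Dom C (fs ! k) = (case k of 0 \<Rightarrow> A | Suc m \<Rightarrow> Cod C (fs ! m)))"
  by (auto simp: nerve_def vertex_def hom_def split: nat.splits)

lemma nth_face:
  assumes "length fs = n" "0 < i" "i < n" "k < n - 1"
  shows "(take (i - 1) fs @ [x] @ drop (i + 1) fs) ! k =
    (if k < i - 1 then fs ! k else if k = i - 1 then x else fs ! Suc k)"
  using assms by (auto simp: nth_append min_def nth_Cons')

lemma nth_degen:
  assumes "length fs = n" "i \<le> n" "k < Suc n"
  shows "(take i fs @ [x] @ drop i fs) ! k =
    (if k < i then fs ! k else if k = i then x else fs ! (k - 1))"
  using assms by (auto simp: nth_append min_def nth_Cons')

definition face_nth :: "('o, 'a) cat \<Rightarrow> nat \<Rightarrow> 'a list \<Rightarrow> nat \<Rightarrow> 'a" where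
  "face_nth C i fs k =
     (if Suc k < i then fs ! k
      else if Suc k = i then fs ! Suc k \<cdot>\<^bsub>C\<^esub> fs ! k
      else fs ! Suc k)"

lemma face_props:
  assumes "length fs = Suc n" "i \<le> Suc n"
  shows "length (snd (nerve_face C (Suc n) i (A, fs))) = n"
    and "k < n \<Longrightarrow> snd (nerve_face C (Suc n) i (A, fs)) ! k = face_nth C i fs k"
    and "fst (nerve_face C (Suc n) i (A, fs)) = (if i = 0 then Cod C (fs ! 0) else A)"
proof -
  show "length (snd (nerve_face C (Suc n) i (A, fs))) = n"
    using assms by (auto simp: nerve_face_def)
  show "fst (nerve_face C (Suc n) i (A, fs)) = (if i = 0 then Cod C (fs ! 0) else A)"
    by (auto simp: nerve_face_def vertex_def Let_def)
  assume k: "k < n"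
  show "snd (nerve_face C (Suc n) i (A, fs)) ! k = face_nth C i fs k"
  proof (cases "0 < i \<and> i < Suc n")
    case True
    then show ?thesis
      using nth_face[of fs "Suc n" i k "fs ! i \<cdot>\<^bsub>C\<^esub> fs ! (i - 1)"] assms k
      by (cases i) (auto simp: nerve_face_def face_nth_def Let_def)
  next
    case False
    then show ?thesis
      using assms k by (auto simp: nerve_face_def face_nth_def Let_def nth_tl nth_butlast)
  qed
qed

lemma degen_props:
  assumes "length fs = n" "i \<le> n"
  shows "length (snd (nerve_degen C n i (A, fs))) = Suc n"
    and "k < Suc n \<Longrightarrow> snd (nerve_degen C n i (A, fs)) ! k =
      (if k < i then fs ! k else if k = i then Idt C (if i = 0 then A else Cod C (fs ! (i - 1)))
       else fs ! (k - 1))"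
    and "fst (nerve_degen C n i (A, fs)) = A"
  using assms nth_degen[of fs n i k "Idt C (vertex C (A, fs) i)"]
  by (auto simp: nerve_degen_def vertex_def Let_def split: nat.split)

lemma simplex_eqI:
  assumes "fst x = fst y" "length (snd x) = n" "length (snd y) = n"
    and "\<And>k. k < n \<Longrightarrow> snd x ! k = snd y ! k"
  shows "x = y"
  using assms by (simp add: prod_eq_iff list_eq_iff_nth_eq)

context category
begin

lemma Cmp_simps:
  assumes "f \<in> Arr C" "g \<in> Arr C" "Dom C g = Cod C f"
  shows "g \<cdot> f \<in> Arr C" "Dom C (g \<cdot> f) = Dom C f" "Cod C (g \<cdot> f) = Cod C g"
  using Cmp_hom[of f "Dom C f" "Cod C f" g "Cod C g"] assms by (auto simp: hom_def)

lemma Idt_simps: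
  assumes "A \<in> Obj C"
  shows "Idt C A \<in> Arr C" "Dom C (Idt C A) = A" "Cod C (Idt C A) = A"
  using Idt_hom[OF assms] by (auto simp: hom_def)

lemma Cmp_assoc':
  assumes "f \<in> Arr C" "g \<in> Arr C" "h \<in> Arr C" "Dom C g = Cod C f" "Dom C h = Cod C g"
  shows "h \<cdot> (g \<cdot> f) = (h \<cdot> g) \<cdot> f"
  using Cmp_assoc[of f "Dom C f" "Cod C f" g "Cod C g" h "Cod C h"] assms by (auto simp: hom_def)

lemma Idt_Cmp:
  assumes "f \<in> Arr C"
  shows "f \<cdot> Idt C (Dom C f) = f" "Idt C (Cod C f) \<cdot> f = f"
  using Cmp_Idt_right[of f] Cmp_Idt_left[of f] assms by (auto simp: hom_def)

lemma nerveD: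
  assumes "x \<in> nerve C n"
  obtains A fs where "x = (A, fs)" "A \<in> Obj C" "length fs = n"
    "\<And>k. k < n \<Longrightarrow> fs ! k \<in> Arr C" "0 < n \<Longrightarrow> Dom C (fs ! 0) = A"
    "\<And>k. Suc k < n \<Longrightarrow> Dom C (fs ! Suc k) = Cod C (fs ! k)"
  using assms by (cases x) (fastforce simp: nerve_iff split: nat.splits)

lemma nerveI:
  assumes "fst x \<in> Obj C" "length (snd x) = n"
    "\<And>k. k < n \<Longrightarrow> snd x ! k \<in> Arr C" "0 < n \<Longrightarrow> Dom C (snd x ! 0) = fst x"
    "\<And>k. Suc k < n \<Longrightarrow> Dom C (snd x ! Suc k) = Cod C (snd x ! k)"
  shows "x \<in> nerve C n"
  using assms by (cases x) (auto simp: nerve_iff split: nat.splits)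

lemma nerve_face_in:
  assumes "x \<in> nerve C (Suc n)" "i \<le> Suc n"
  shows "nerve_face C (Suc n) i x \<in> nerve C n"
  using assms(1)
proof (rule nerveD)
  fix A fs assume x: "x = (A, fs)" and A: "A \<in> Obj C" and l: "length fs = Suc n"
    and arr: "\<And>k. k < Suc n \<Longrightarrow> fs ! k \<in> Arr C" and d0: "0 < Suc n \<Longrightarrow> Dom C (fs ! 0) = A"
    and dS: "\<And>k. Suc k < Suc n \<Longrightarrow> Dom C (fs ! Suc k) = Cod C (fs ! k)"
  note F = face_props[OF l assms(2), where C=C and A=A]
  have c: "fs ! Suc m \<cdot> fs ! m \<in> Arr C"
      "Dom C (fs ! Suc m \<cdot> fs ! m) = Dom C (fs ! m)"
      "Cod C (fs ! Suc m \<cdot> fs ! m) = Cod C (fs ! Suc m)" if "m < n" for m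
    using Cmp_simps[of "fs ! m" "fs ! Suc m"] arr[of m] arr[of "Suc m"] dS[of m] that by auto
  show ?thesis unfolding x
  proof (rule nerveI)
    show "fst (nerve_face C (Suc n) i (A, fs)) \<in> Obj C"
      using F(3) A Cod_Obj[OF arr[of 0]] by auto
    show "length (snd (nerve_face C (Suc n) i (A, fs))) = n" by (rule F(1))
    show "snd (nerve_face C (Suc n) i (A, fs)) ! k \<in> Arr C" if "k < n" for k
      using F(2)[OF that] c[of k] arr[of k] arr[of "Suc k"] that by (auto simp: face_nth_def)
    show "Dom C (snd (nerve_face C (Suc n) i (A, fs)) ! 0) = fst (nerve_face C (Suc n) i (A, fs))"
      if "0 < n"
      using F(2)[OF that] F(3) c[of 0] d0 dS[of 0] that assms(2) by (auto simp: face_nth_def)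
    show "Dom C (snd (nerve_face C (Suc n) i (A, fs)) ! Suc k) =
        Cod C (snd (nerve_face C (Suc n) i (A, fs)) ! k)" if "Suc k < n" for k
      using F(2)[OF that] F(2)[of k] c[of k] c[of "Suc k"] dS[of k] dS[of "Suc k"] that
      by (auto simp: face_nth_def)

  qed
qed

lemma nerve_degen_in:
  assumes "x \<in> nerve C n" "i \<le> n"
  shows "nerve_degen C n i x \<in> nerve C (Suc n)"
  using assms(1)
proof (rule nerveD)
  fix A fs assume x: "x = (A, fs)" and A: "A \<in> Obj C" and l: "length fs = n"
    and arr: "\<And>k. k < n \<Longrightarrow> fs ! k \<in> Arr C" and d0: "0 < n \<Longrightarrow> Dom C (fs ! 0) = A"
    and dS: "\<And>k. Suc k < n \<Longrightarrow> Dom C (fs ! Suc k) = Cod C (fs ! k)"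
  note D = degen_props[OF l assms(2), where C=C and A=A]
  let ?V = "if i = 0 then A else Cod C (fs ! (i - 1))"
  have V: "?V \<in> Obj C" using A Cod_Obj[OF arr[of "i - 1"]] assms(2) by auto
  note c = Idt_simps[OF V]
  show ?thesis unfolding x
  proof (rule nerveI)
    show "fst (nerve_degen C n i (A, fs)) \<in> Obj C" using D(3) A by simp
    show "length (snd (nerve_degen C n i (A, fs))) = Suc n" by (rule D(1))
    show "snd (nerve_degen C n i (A, fs)) ! k \<in> Arr C" if "k < Suc n" for k
      using D(2)[OF that] c(1) arr[of k] arr[of "k - 1"] assms(2) that by auto
    show "Dom C (snd (nerve_degen C n i (A, fs)) ! 0) = fst (nerve_degen C n i (A, fs))"
      using D(2)[of 0] D(3) c(2) d0 assms(2) by auto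
    show "Dom C (snd (nerve_degen C n i (A, fs)) ! Suc k) =
        Cod C (snd (nerve_degen C n i (A, fs)) ! k)" if "Suc k < Suc n" for k
    proof -
      consider "Suc k < i" | "Suc k = i" | "k = i" | "i < k" by linarith
      then show ?thesis
        using D(2)[OF that] D(2)[of k] c d0 dS[of k] dS[of "k - 1"] that assms(2)
        by cases auto
    qed
  qed
qed

lemma simplicial_set_nerve: "simplicial_set (nerve C) (nerve_face C) (nerve_degen C)"
proof (rule simplicial_set.intro)
  show "nerve_face C (Suc n) i x \<in> nerve C n" if "x \<in> nerve C (Suc n)" "i \<le> Suc n" for x n i
    using nerve_face_in that .
  show "nerve_degen C n i x \<in> nerve C (Suc n)" if "x \<in> nerve C n" "i \<le> n" for x n i
    using nerve_degen_in that .
next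
  fix x n and i j :: nat
  assume x: "x \<in> nerve C (Suc (Suc n))" and ij: "i < j" "j \<le> Suc (Suc n)"
  from x show "nerve_face C (Suc n) i (nerve_face C (Suc (Suc n)) j x) =
    nerve_face C (Suc n) (j - 1) (nerve_face C (Suc (Suc n)) i x)"
  proof (rule nerveD)
    fix A fs assume xe: "x = (A, fs)" and l: "length fs = Suc (Suc n)"
      and arr: "\<And>k. k < Suc (Suc n) \<Longrightarrow> fs ! k \<in> Arr C"
      and dS: "\<And>k. Suc k < Suc (Suc n) \<Longrightarrow> Dom C (fs ! Suc k) = Cod C (fs ! k)"
    define y z where "y = nerve_face C (Suc (Suc n)) j (A, fs)"
      and "z = nerve_face C (Suc (Suc n)) i (A, fs)"
    have i': "i \<le> Suc (Suc n)" and i: "i \<le> Suc n" and j: "j - 1 \<le> Suc n" using ij by auto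
    note Y = face_props[OF l ij(2), where C=C and A=A, folded y_def]
    note Z = face_props[OF l i', where C=C and A=A, folded z_def]
    note Y' = face_props[OF Y(1) i, where C=C and A="fst y", unfolded prod.collapse]
    note Z' = face_props[OF Z(1) j, where C=C and A="fst z", unfolded prod.collapse]
    have cd: "Cod C (fs ! Suc 0 \<cdot> fs ! 0) = Cod C (fs ! Suc 0)"
      using Cmp_simps(3)[of "fs ! 0" "fs ! Suc 0"] arr[of 0] arr[of "Suc 0"] dS[of 0] by simp
    have "nerve_face C (Suc n) i y = nerve_face C (Suc n) (j - 1) z"
    proof (rule simplex_eqI)
      show "length (snd (nerve_face C (Suc n) i y)) = n" by (rule Y')
      show "length (snd (nerve_face C (Suc n) (j - 1) z)) = n" by (rule Z')
      show "fst (nerve_face C (Suc n) i y) = fst (nerve_face C (Suc n) (j - 1) z)"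
        using Y'(3) Z'(3) Y(3) Z(3) Y(2)[of 0] Z(2)[of 0] ij cd
        by (cases "j = Suc 0") (auto simp: face_nth_def)
      fix k assume k: "k < n"
      have as': "(fs ! Suc (Suc k) \<cdot> fs ! Suc k) \<cdot> fs ! k =
          fs ! Suc (Suc k) \<cdot> (fs ! Suc k \<cdot> fs ! k)"
        using Cmp_assoc'[of "fs ! k" "fs ! Suc k" "fs ! Suc (Suc k)"] arr[of k] arr[of "Suc k"]
          arr[of "Suc (Suc k)"] dS[of k] dS[of "Suc k"] k by simp
      have yz: "snd y ! k = face_nth C j fs k" "snd y ! Suc k = face_nth C j fs (Suc k)"
          "snd z ! k = face_nth C i fs k" "snd z ! Suc k = face_nth C i fs (Suc k)"
        using Y(2) Z(2) k by auto
      obtain p where p: "j = Suc p" "i \<le> p" using ij by (cases j) auto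
      show "snd (nerve_face C (Suc n) i y) ! k = snd (nerve_face C (Suc n) (j - 1) z) ! k"
        unfolding Y'(2)[OF k] Z'(2)[OF k] face_nth_def[of C i "snd y"] face_nth_def[of C "j - 1" "snd z"] yz
        using p(2) by (auto simp: face_nth_def p(1) as')
    qed
    then show ?thesis by (simp add: xe y_def z_def)
  qed
next
  fix x n and i j :: nat
  assume x: "x \<in> nerve C (Suc n)" and ij: "i < j" "j \<le> Suc n"
  from x show "nerve_face C (Suc (Suc n)) i (nerve_degen C (Suc n) j x) =
    nerve_degen C n (j - 1) (nerve_face C (Suc n) i x)"
  proof (rule nerveD)
    fix A fs assume xe: "x = (A, fs)" and l: "length fs = Suc n"
      and arr: "\<And>k. k < Suc n \<Longrightarrow> fs ! k \<in> Arr C"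
      and dS: "\<And>k. Suc k < Suc n \<Longrightarrow> Dom C (fs ! Suc k) = Cod C (fs ! k)"
    define y z where "y = nerve_degen C (Suc n) j (A, fs)"
      and "z = nerve_face C (Suc n) i (A, fs)"
    have i': "i \<le> Suc n" and i: "i \<le> Suc (Suc n)" and j: "j - 1 \<le> n" using ij by auto
    note Y = degen_props[OF l ij(2), where C=C and A=A, folded y_def]
    note Z = face_props[OF l i', where C=C and A=A, folded z_def]
    note Y' = face_props[OF Y(1) i, where C=C and A="fst y", unfolded prod.collapse]
    note Z' = degen_props[OF Z(1) j, where C=C and A="fst z", unfolded prod.collapse]
    have cd: "Cod C (fs ! i \<cdot> fs ! (i - 1)) = Cod C (fs ! i)" if "0 < i"
      using Cmp_simps(3)[of "fs ! (i - 1)" "fs ! i"] arr[of i] arr[of "i - 1"] dS[of "i - 1"]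
        ij that by simp
    have "nerve_face C (Suc (Suc n)) i y = nerve_degen C n (j - 1) z"
    proof (rule simplex_eqI)
      show "length (snd (nerve_face C (Suc (Suc n)) i y)) = Suc n" by (rule Y')
      show "length (snd (nerve_degen C n (j - 1) z)) = Suc n" by (rule Z')
      show "fst (nerve_face C (Suc (Suc n)) i y) = fst (nerve_degen C n (j - 1) z)"
        using Y'(3) Z'(3) Y(3) Z(3) Y(2)[of 0] ij by auto
      fix k assume k: "k < Suc n"
      obtain p where p: "j = Suc p" "i \<le> p" "p \<le> n" using ij by (cases j) auto
      have y: "snd y ! m = (if m < j then fs ! m else if m = j then Idt C (Cod C (fs ! p))
          else fs ! (m - 1))" if "m < Suc (Suc n)" for m
        using Y(2)[OF that] p by simp
      have z: "snd z ! m = face_nth C i fs m" if "m < n" for m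
        using Z(2)[OF that] .
      have v: "(if j - 1 = 0 then fst z else Cod C (snd z ! (j - 1 - 1))) = Cod C (fs ! p)"
        using Z(3) z[of "p - 1"] p cd by (cases p) (auto simp: face_nth_def)
      have z': "snd (nerve_degen C n (j - 1) z) ! k = (if k < p then face_nth C i fs k
          else if k = p then Idt C (Cod C (fs ! p)) else face_nth C i fs (k - 1))"
        using Z'(2)[OF k] k p z[of k] z[of "k - 1"] unfolding v by auto
      show "snd (nerve_face C (Suc (Suc n)) i y) ! k = snd (nerve_degen C n (j - 1) z) ! k"
        unfolding Y'(2)[OF k] z' face_nth_def[of C i "snd y"]
        using y[of k] y[of "Suc k"] k p by (auto simp: face_nth_def)
    qed
    then show ?thesis by (simp add: xe y_def z_def)
  qed
next
  fix x n and i j :: nat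
  assume x: "x \<in> nerve C n" and ij: "j \<le> n" "i = j \<or> i = Suc j"
  from x show "nerve_face C (Suc n) i (nerve_degen C n j x) = x"
  proof (rule nerveD)
    fix A fs assume xe: "x = (A, fs)" and l: "length fs = n" and A: "A \<in> Obj C"
      and arr: "\<And>k. k < n \<Longrightarrow> fs ! k \<in> Arr C" and d0: "0 < n \<Longrightarrow> Dom C (fs ! 0) = A"
      and dS: "\<And>k. Suc k < n \<Longrightarrow> Dom C (fs ! Suc k) = Cod C (fs ! k)"
    define y where "y = nerve_degen C n j (A, fs)"
    have i: "i \<le> Suc n" using ij by auto
    note Y = degen_props[OF l ij(1), where C=C and A=A, folded y_def]
    note Y' = face_props[OF Y(1) i, where C=C and A="fst y", unfolded prod.collapse]
    have l1: "Idt C (Cod C (fs ! (j - 1))) \<cdot> fs ! (j - 1) = fs ! (j - 1)" if "0 < j"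
      using Idt_Cmp(2)[OF arr[of "j - 1"]] that ij by auto
    have r1: "fs ! j \<cdot> Idt C (Dom C (fs ! j)) = fs ! j" if "j < n"
      using Idt_Cmp(1)[OF arr[of j]] that by auto
    have dj: "Dom C (fs ! j) = (if j = 0 then A else Cod C (fs ! (j - 1)))" if "j < n"
      using d0 dS[of "j - 1"] that by auto
    have "nerve_face C (Suc n) i y = (A, fs)"
    proof (rule simplex_eqI)
      show "length (snd (nerve_face C (Suc n) i y)) = n" by (rule Y')
      show "length (snd (A, fs)) = n" using l by simp
      show "fst (nerve_face C (Suc n) i y) = fst (A, fs)"
        using Y'(3) Y(3) Y(2)[of 0] ij Idt_simps[OF A] by auto
      fix k assume k: "k < n"
      show "snd (nerve_face C (Suc n) i y) ! k = snd (A, fs) ! k"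
        using ij(2)
      proof
        assume "i = j"
        then show ?thesis
          using Y'(2)[OF k] Y(2) ij k l1
          unfolding face_nth_def by (cases j) auto
      next
        assume "i = Suc j"
        then show ?thesis
          using Y'(2)[OF k] Y(2) ij k r1 dj
          unfolding face_nth_def by auto
      qed
    qed
    then show ?thesis by (simp add: xe y_def)
  qed
next
  fix x n and i j :: nat
  assume x: "x \<in> nerve C (Suc n)" and ij: "Suc j < i" "i \<le> Suc (Suc n)"
  from x show "nerve_face C (Suc (Suc n)) i (nerve_degen C (Suc n) j x) =
    nerve_degen C n j (nerve_face C (Suc n) (i - 1) x)"
  proof (rule nerveD)
    fix A fs assume xe: "x = (A, fs)" and l: "length fs = Suc n"
    define y z where "y = nerve_degen C (Suc n) j (A, fs)"
      and "z = nerve_face C (Suc n) (i - 1) (A, fs)"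
    have j': "j \<le> Suc n" and i: "i - 1 \<le> Suc n" and j: "j \<le> n" using ij by auto
    note Y = degen_props[OF l j', where C=C and A=A, folded y_def]
    note Z = face_props[OF l i, where C=C and A=A, folded z_def]
    note Y' = face_props[OF Y(1) ij(2), where C=C and A="fst y", unfolded prod.collapse]
    note Z' = degen_props[OF Z(1) j, where C=C and A="fst z", unfolded prod.collapse]
    have "nerve_face C (Suc (Suc n)) i y = nerve_degen C n j z"
    proof (rule simplex_eqI)
      show "length (snd (nerve_face C (Suc (Suc n)) i y)) = Suc n" by (rule Y')
      show "length (snd (nerve_degen C n j z)) = Suc n" by (rule Z')
      show "fst (nerve_face C (Suc (Suc n)) i y) = fst (nerve_degen C n j z)"
        using Y'(3) Z'(3) Y(3) Z(3) ij by auto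
      fix k assume k: "k < Suc n"
      obtain p where p: "i = Suc p" "j < p" "p \<le> Suc n" using ij by (cases i) auto
      let ?V = "if j = 0 then A else Cod C (fs ! (j - 1))"
      have y: "snd y ! m = (if m < j then fs ! m else if m = j then Idt C ?V
          else fs ! (m - 1))" if "m < Suc (Suc n)" for m
        using Y(2)[OF that] .
      have z: "snd z ! m = face_nth C p fs m" if "m < n" for m
        using Z(2)[OF that] p(1) by simp
      have v: "(if j = 0 then fst z else Cod C (snd z ! (j - 1))) = ?V"
        using Z(3) z[of "j - 1"] p by (auto simp: face_nth_def)
      have z': "snd (nerve_degen C n j z) ! k = (if k < j then face_nth C p fs k
          else if k = j then Idt C ?V else face_nth C p fs (k - 1))"
        using Z'(2)[OF k] k p z[of k] z[of "k - 1"] unfolding v by auto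
      show "snd (nerve_face C (Suc (Suc n)) i y) ! k = snd (nerve_degen C n j z) ! k"
        unfolding Y'(2)[OF k] z' face_nth_def[of C i "snd y"]
        using y[of k] y[of "Suc k"] k p by (auto simp: face_nth_def)
    qed
    then show ?thesis by (simp add: xe y_def z_def)
  qed
next
  fix x n and i j :: nat
  assume x: "x \<in> nerve C n" and ij: "i \<le> j" "j \<le> n"
  from x show "nerve_degen C (Suc n) i (nerve_degen C n j x) =
    nerve_degen C (Suc n) (Suc j) (nerve_degen C n i x)"
  proof (rule nerveD)
    fix A fs assume xe: "x = (A, fs)" and l: "length fs = n" and A: "A \<in> Obj C"
      and arr: "\<And>k. k < n \<Longrightarrow> fs ! k \<in> Arr C"
    define y z where "y = nerve_degen C n j (A, fs)" and "z = nerve_degen C n i (A, fs)"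
    have i': "i \<le> n" and i: "i \<le> Suc n" and j: "Suc j \<le> Suc n" using ij by auto
    note Y = degen_props[OF l ij(2), where C=C and A=A, folded y_def]
    note Z = degen_props[OF l i', where C=C and A=A, folded z_def]
    note Y' = degen_props[OF Y(1) i, where C=C and A="fst y", unfolded prod.collapse]
    note Z' = degen_props[OF Z(1) j, where C=C and A="fst z", unfolded prod.collapse]
    have V: "(if i = 0 then A else Cod C (fs ! (i - 1))) \<in> Obj C"
      using A Cod_Obj[OF arr[of "i - 1"]] i' by auto
    have "nerve_degen C (Suc n) i y = nerve_degen C (Suc n) (Suc j) z"
    proof (rule simplex_eqI)
      show "length (snd (nerve_degen C (Suc n) i y)) = Suc (Suc n)" by (rule Y')
      show "length (snd (nerve_degen C (Suc n) (Suc j) z)) = Suc (Suc n)" by (rule Z')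
      show "fst (nerve_degen C (Suc n) i y) = fst (nerve_degen C (Suc n) (Suc j) z)"
        using Y'(3) Z'(3) Y(3) Z(3) by auto
      fix k assume k: "k < Suc (Suc n)"
      let ?V = "\<lambda>i. if i = 0 then A else Cod C (fs ! (i - 1))"
      have vy: "(if i = 0 then fst y else Cod C (snd y ! (i - 1))) = ?V i"
        using Y(3) Y(2)[of "i - 1"] ij by auto
      have vz: "(if Suc j = 0 then fst z else Cod C (snd z ! (Suc j - 1))) = ?V j"
        using Z(2)[of j] ij Idt_simps[OF V] by auto
      show "snd (nerve_degen C (Suc n) i y) ! k = snd (nerve_degen C (Suc n) (Suc j) z) ! k"
        unfolding Y'(2)[OF k] Z'(2)[OF k] vy vz
        using Y(2)[of k] Y(2)[of "k - 1"] Z(2)[of k] Z(2)[of "k - 1"] ij k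
        by (cases k) auto
    qed
    then show ?thesis by (simp add: xe y_def z_def)
  qed
qed

end

end

theory Submission imports Defs begin

text \<open>
  The structure \<open>t\<close> on the nerve is determined by what it does in dimensions \<open>0\<close> and \<open>1\<close>.
  It sends an object \<open>B\<close> to an object \<open>tB\<close>, and the face identities in dimension \<open>1\<close> make it
  send \<open>f: A \<rightarrow> B\<close> to an arrow \<open>\<tau> f: tB \<rightarrow> A\<close>.  The face identities in dimension \<open>2\<close> say that
  \<open>f \<cdot> \<tau> (g \<cdot> f) = \<tau> g\<close>, and the identity for \<open>t\<^sup>2 s\<^sub>0\<close> on objects says that \<open>\<tau> (\<tau> 1) = 1\<close>.
  Conversely, such a \<open>\<tau>\<close> gives the whole structure:
  \<open>A\<^sub>0 \<rightarrow> \<dots> \<rightarrow> A\<^sub>n\<close> is sent to \<open>tA\<^sub>n \<rightarrow> A\<^sub>0 \<rightarrow> \<dots> \<rightarrow> A\<^bsub>n-1\<^esub>\<close>, the first arrow being \<open>\<tau>\<close> of the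
  composite of the simplex.  The locale \<open>lifting_structure\<close> isolates these data, and
  \<open>duplicial_iff_lifting\<close> is the equivalence.

  The arrow \<open>\<epsilon>\<^sub>B = \<tau> 1\<^sub>B: tB \<rightarrow> B\<close> satisfies \<open>f \<cdot> \<tau> f = \<epsilon>\<^sub>B\<close>, so \<open>\<tau>\<close> is a choice of lifts
  of \<open>\<epsilon>\<^sub>B\<close> along all arrows into \<open>B\<close>.  As \<open>\<tau> \<epsilon>\<^sub>B = 1\<close>, the law
  \<open>f \<cdot> \<tau> (\<epsilon>\<^sub>B \<cdot> f) = \<tau> \<epsilon>\<^sub>B\<close> makes every arrow \<open>f\<close> into \<open>tB\<close> a split epimorphism.  An arrow
  between objects of the form \<open>tB\<close> has a section that is itself split epic, hence it is
  invertible, and the full subcategory on these objects is a groupoid.  The functor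
  \<open>f \<mapsto> \<tau> (\<tau> f)\<close> is a coreflection of \<open>C\<close> onto it with counit \<open>\<epsilon>\<close>; the unit is the inverse
  of the counit, which exists in the groupoid.

  In the other direction, for \<open>L \<stileturn> R\<close> with \<open>R\<close> valued in a groupoid every \<open>R f\<close> is invertible,
  and \<open>\<tau> f = \<epsilon>\<^sub>A \<cdot> L (R f)\<^sup>-\<^sup>1: L R B \<rightarrow> L R A \<rightarrow> A\<close> is a lifting structure: the first law is
  naturality of \<open>\<epsilon>\<close>, and \<open>\<tau> \<epsilon>\<^sub>A = 1\<close> combines the two triangle identities.
\<close>

section \<open>Simplices of the nerve as composable lists\<close>

fun composable :: "('o, 'a) cat \<Rightarrow> 'o \<Rightarrow> 'a list \<Rightarrow> bool" where
  "composable C A [] \<longleftrightarrow> A \<in> Obj C"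
| "composable C A (f # fs) \<longleftrightarrow> A \<in> Obj C \<and> f \<in> Arr C \<and> Dom C f = A \<and> composable C (Cod C f) fs"

fun target :: "('o, 'a) cat \<Rightarrow> 'o \<Rightarrow> 'a list \<Rightarrow> 'o" where
  "target C A [] = A"
| "target C A (f # fs) = target C (Cod C f) fs"

fun composite :: "('o, 'a) cat \<Rightarrow> 'o \<Rightarrow> 'a list \<Rightarrow> 'a" where
  "composite C A [] = Idt C A"
| "composite C A (f # fs) = composite C (Cod C f) fs \<cdot>\<^bsub>C\<^esub> f"

lemma target_append: "target C A (fs @ gs) = target C (target C A fs) gs"
  by (induction fs arbitrary: A) auto

lemma vertex_length: "vertex C (A, ps @ qs) (length ps) = target C A ps"
proof (cases ps rule: rev_cases)
  case (snoc rs r)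
  then show ?thesis by (simp add: vertex_def target_append nth_append)
qed (simp add: vertex_def)

lemma nerve_face_first: "nerve_face C n 0 (A, f # fs) = (Cod C f, fs)"
  by (simp add: nerve_face_def vertex_def)

lemma nerve_face_last: "0 < n \<Longrightarrow> nerve_face C n n (A, fs) = (A, butlast fs)"
  by (simp add: nerve_face_def Let_def)

lemma nerve_face_inner:
  assumes "n = Suc (Suc (length ps + length qs))"
  shows "nerve_face C n (Suc (length ps)) (A, ps @ f # g # qs) = (A, ps @ (g \<cdot>\<^bsub>C\<^esub> f) # qs)"
  using assms by (simp add: nerve_face_def Let_def nth_append)

lemma nerve_degen_append:
  "nerve_degen C n (length ps) (A, ps @ qs) = (A, ps @ Idt C (target C A ps) # qs)"
  by (simp add: nerve_degen_def Let_def vertex_length)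

context category
begin

lemma hom_Obj:
  assumes "f \<in> hom C A B"
  shows "A \<in> Obj C" "B \<in> Obj C"
  using assms Dom_Obj Cod_Obj by (auto simp: hom_def)

lemma nerve_iff_composable:
  "(A, fs) \<in> nerve C n \<longleftrightarrow> length fs = n \<and> composable C A fs"
proof (induction fs arbitrary: A n)
  case Nil
  then show ?case by (auto simp: nerve_iff)
next
  case (Cons f fs)
  show ?case
  proof (cases "length (f # fs) = n")
    case True
    have "(\<forall>k < length fs. fs ! k \<in> Arr C \<and> Dom C (fs ! k) = Cod C ((f # fs) ! k)) \<longleftrightarrow>
        (\<forall>k < length fs. fs ! k \<in> Arr C \<and>
          Dom C (fs ! k) = (case k of 0 \<Rightarrow> Cod C f | Suc m \<Rightarrow> Cod C (fs ! m)))"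
      by (simp add: nth_Cons split: nat.splits)
    then have "(A, f # fs) \<in> nerve C n \<longleftrightarrow>
        A \<in> Obj C \<and> f \<in> Arr C \<and> Dom C f = A \<and> (Cod C f, fs) \<in> nerve C (length fs)"
      using True Cod_Obj[of f] by (auto simp: nerve_iff All_less_Suc2 simp flip: True)
    then show ?thesis using Cons[of "Cod C f" "length fs"] True by simp
  qed (auto simp: nerve_iff)
qed

lemma composable_append:
  "composable C A (fs @ gs) \<longleftrightarrow> composable C A fs \<and> composable C (target C A fs) gs"
  by (induction fs arbitrary: A) (auto elim: composable.elims)

lemma target_Obj: "composable C A fs \<Longrightarrow> target C A fs \<in> Obj C"
  by (induction fs arbitrary: A) auto

lemma composable_butlast: "composable C A fs \<Longrightarrow> composable C A (butlast fs)"
  by (cases fs rule: rev_cases) (auto simp: composable_append)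

lemma composite_hom: "composable C A fs \<Longrightarrow> composite C A fs \<in> hom C A (target C A fs)"
proof (induction fs arbitrary: A)
  case Nil
  then show ?case by (simp add: Idt_hom)
next
  case (Cons f fs)
  then have "f \<in> hom C A (Cod C f)"
    "composite C (Cod C f) fs \<in> hom C (Cod C f) (target C (Cod C f) fs)"
    by (auto simp: hom_def)
  then show ?case by (simp add: Cmp_hom)
qed

lemma target_compose:
  assumes "composable C A (ps @ f # g # qs)"
  shows "target C A (ps @ (g \<cdot> f) # qs) = target C A (ps @ f # g # qs)"
  using assms by (auto simp: target_append composable_append Cmp_simps)

lemma composite_compose:
  "composable C A (ps @ f # g # qs) \<Longrightarrow>
    composite C A (ps @ (g \<cdot> f) # qs) = composite C A (ps @ f # g # qs)"
proof (induction ps arbitrary: A)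
  case Nil
  then have fg: "f \<in> hom C A (Cod C f)" "g \<in> hom C (Cod C f) (Cod C g)"
    and "composable C (Cod C g) qs"
    by (auto simp: hom_def)
  from this(3) have "composite C (Cod C g) qs \<in> hom C (Cod C g) (target C (Cod C g) qs)"
    by (rule composite_hom)
  from Cmp_assoc[OF fg this] Cmp_hom[OF fg] show ?case by (simp add: hom_def)
qed simp

lemma target_insert_Idt:
  assumes "composable C A (ps @ qs)"
  shows "target C A (ps @ Idt C (target C A ps) # qs) = target C A (ps @ qs)"
proof -
  have "target C A ps \<in> Obj C"
    using assms by (auto simp: composable_append target_Obj)
  then show ?thesis by (simp add: target_append Idt_simps)
qed

lemma composite_insert_Idt:
  "composable C A (ps @ qs) \<Longrightarrow>
    composite C A (ps @ Idt C (target C A ps) # qs) = composite C A (ps @ qs)"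
proof (induction ps arbitrary: A)
  case Nil
  then have "A \<in> Obj C" by (cases qs) auto
  then show ?case
    using Cmp_Idt_right[OF composite_hom[of A qs]] Nil by (simp add: Idt_simps)
qed simp

end

section \<open>Lifting structures\<close>

text \<open>
  The restriction of a duplicial structure on the nerve to dimensions \<open>0\<close> and \<open>1\<close>, with the
  laws that the dimensions up to \<open>2\<close> impose on it.
\<close>

locale lifting_structure = category C for C :: "('o, 'a) cat" (structure) +
  fixes t\<^sub>0 :: "'o \<Rightarrow> 'o" and \<tau> :: "'a \<Rightarrow> 'a"
  assumes t\<^sub>0_Obj: "A \<in> Obj C \<Longrightarrow> t\<^sub>0 A \<in> Obj C"
    and \<tau>_hom: "f \<in> hom C A B \<Longrightarrow> \<tau> f \<in> hom C (t\<^sub>0 B) A"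
    and \<tau>_Cmp: "f \<in> hom C A B \<Longrightarrow> g \<in> hom C B D \<Longrightarrow> f \<cdot> \<tau> (g \<cdot> f) = \<tau> g"
    and \<tau>_\<tau>_Idt: "A \<in> Obj C \<Longrightarrow> \<tau> (\<tau> (Idt C A)) = Idt C (t\<^sub>0 A)"
begin

lemma Cmp_\<tau>: "f \<in> hom C A B \<Longrightarrow> f \<cdot> \<tau> f = \<tau> (Idt C B)"
  using \<tau>_Cmp[of f A B "Idt C B" B] Cod_Obj[of f] Idt_hom[of B] Cmp_Idt_left[of f A B]
  by (auto simp: hom_def)

text \<open>
  Dropping the last arrow after consing treats all dimensions alike: for an object the list
  \<open>[\<tau> 1]\<close> becomes empty, as a \<open>0\<close>-simplex requires.
\<close>

definition rotate_simplex :: "('o, 'a) simplex \<Rightarrow> ('o, 'a) simplex" where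
  "rotate_simplex x = (case x of (A, fs) \<Rightarrow>
     (t\<^sub>0 (target C A fs), butlast (\<tau> (composite C A fs) # fs)))"

lemma composable_\<tau>_composite:
  assumes "composable C A fs"
  shows "composable C (t\<^sub>0 (target C A fs)) (\<tau> (composite C A fs) # fs)"
  using \<tau>_hom[OF composite_hom[OF assms]] assms target_Obj[OF assms]
  by (simp add: hom_def t\<^sub>0_Obj)

lemma rotate_simplex_in_nerve:
  assumes "x \<in> nerve C n"
  shows "rotate_simplex x \<in> nerve C n"
proof -
  obtain A fs where x: "x = (A, fs)" by (cases x)
  then have "length fs = n" "composable C A fs"
    using assms by (auto simp: nerve_iff_composable)
  then show ?thesis
    using composable_butlast[OF composable_\<tau>_composite]
    by (simp add: x rotate_simplex_def nerve_iff_composable del: butlast.simps)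
qed

text \<open>
  For \<open>1 = i < n\<close> the face composes the new first arrow with the old one, and the claim becomes
  the law \<open>f \<cdot> \<tau> (g \<cdot> f) = \<tau> g\<close>, with \<open>g\<close> the composite of the remaining arrows.  For
  \<open>1 < i < n\<close> both sides compose the same two old arrows, and for \<open>1 < i = n\<close> both sides lose the
  last two of them; the composite of the simplex does not change.
\<close>

lemma face_rotate_simplex:
  assumes x: "x \<in> nerve C n" and i: "1 \<le> i" "i \<le> n"
  shows "nerve_face C n i (rotate_simplex x) = rotate_simplex (nerve_face C n (i - 1) x)"
proof -
  obtain A fs where x_eq: "x = (A, fs)" by (cases x)
  have l: "length fs = n" and c: "composable C A fs"
    using x by (auto simp: x_eq nerve_iff_composable)
  consider (one) "n = 1" | (first) "i = 1" "1 < n" | (inner) "1 < i" "i \<le> n"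
    using i by linarith
  then show ?thesis
  proof cases
    case one
    then obtain f where "fs = [f]" using l by (auto simp: length_Suc_conv)
    then show ?thesis
      using one i nerve_face_last[of 1 C]
      by (simp add: x_eq rotate_simplex_def nerve_face_first le_antisym)
  next
    case first
    then obtain f g gs where fs: "fs = f # g # gs"
      using l by (cases fs; cases "tl fs") auto
    have f: "f \<in> hom C A (Cod C f)" and gs: "composable C (Cod C f) (g # gs)"
      using c by (auto simp: fs hom_def)
    define qs where "qs = butlast (g # gs)"
    have "butlast (k # f # g # gs) = k # f # qs" for k by (simp add: qs_def)
    moreover have "n = Suc (Suc (length qs))" using l by (auto simp: qs_def fs)
    ultimately have "nerve_face C n i (rotate_simplex x) =
        (t\<^sub>0 (target C A fs), (f \<cdot> \<tau> (composite C A fs)) # qs)"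
      using nerve_face_inner[of n "[]" qs C _ _ f] first(1)
      by (simp add: x_eq fs rotate_simplex_def)
    also have "f \<cdot> \<tau> (composite C A fs) = \<tau> (composite C (Cod C f) (g # gs))"
      using \<tau>_Cmp[OF f composite_hom[OF gs]] by (simp add: fs)
    finally show ?thesis
      using first(1) by (simp add: x_eq fs rotate_simplex_def nerve_face_first qs_def)
  next
    case inner
    define ps where "ps = take (i - 2) fs"
    \<comment> \<open>The two arrows that \<open>d\<^bsub>i-1\<^esub>\<close> composes.\<close>
    obtain f g qs where fs: "fs = ps @ f # g # qs" and ps: "length ps = i - 2"
    proof -
      have "fs = ps @ fs ! (i - 2) # fs ! (i - 1) # drop i fs"
        using Cons_nth_drop_Suc[of "i - 2" fs] Cons_nth_drop_Suc[of "i - 1" fs] inner l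
          append_take_drop_id[of "i - 2" fs]
        by (simp add: ps_def Suc_diff_Suc numeral_2_eq_2)
      moreover have "length ps = i - 2" using inner l by (simp add: ps_def)
      ultimately show ?thesis using that by blast
    qed
    let ?k = "\<tau> (composite C A fs)"
    have face: "nerve_face C n (i - 1) x = (A, ps @ (g \<cdot> f) # qs)"
      using nerve_face_inner[of n ps qs C A f g] inner l
      by (simp add: x_eq fs ps Suc_diff_Suc numeral_2_eq_2)
    have R: "rotate_simplex (A, ps @ (g \<cdot> f) # qs) =
        (t\<^sub>0 (target C A fs), butlast (?k # ps @ (g \<cdot> f) # qs))"
      using composite_compose[of A ps f g qs] target_compose[of A ps f g qs] c
      by (simp add: rotate_simplex_def fs)
    have L: "rotate_simplex x = (t\<^sub>0 (target C A fs), butlast ((?k # ps) @ f # g # qs))"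
      by (simp add: x_eq rotate_simplex_def fs)
    show ?thesis
    proof (cases qs rule: rev_cases)
      case Nil
      then have "n = i" using l ps inner by (simp add: fs)
      then show ?thesis
        using Nil nerve_face_last[of n C] inner unfolding face L R
        by (simp add: fs butlast_append)
    next
      case (snoc rs r)
      then show ?thesis
        using nerve_face_inner[of n "?k # ps" rs C _ f g] l ps inner unfolding face L R
        by (simp add: fs butlast_append Suc_diff_Suc numeral_2_eq_2)
    qed
  qed
qed

lemma face_0_rotate_simplex:
  assumes "x \<in> nerve C n" "1 \<le> n"
  shows "nerve_face C n 0 (rotate_simplex x) = nerve_face C n n x"
proof -
  obtain A fs where x: "x = (A, fs)" by (cases x)
  then have l: "length fs = n" and c: "composable C A fs"
    using assms by (auto simp: nerve_iff_composable)
  have "fs \<noteq> []" using l assms(2) by auto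
  moreover have "Cod C (\<tau> (composite C A fs)) = A"
    using \<tau>_hom[OF composite_hom[OF c]] by (simp add: hom_def)
  ultimately show ?thesis
    using assms(2) by (simp add: x rotate_simplex_def nerve_face_first nerve_face_last)
qed

lemma degen_rotate_simplex:
  assumes x: "x \<in> nerve C n" and j: "1 \<le> j" "j \<le> n"
  shows "nerve_degen C n j (rotate_simplex x) = rotate_simplex (nerve_degen C n (j - 1) x)"
proof -
  obtain A fs where x_eq: "x = (A, fs)" by (cases x)
  have l: "length fs = n" and c: "composable C A fs"
    using x by (auto simp: x_eq nerve_iff_composable)
  define ps qs where "ps = take (j - 1) fs" and "qs = drop (j - 1) fs"
  have fs: "fs = ps @ qs" and ps: "length ps = j - 1" and qs: "qs \<noteq> []"
    using j l by (auto simp: ps_def qs_def)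
  let ?k = "\<tau> (composite C A fs)"
  have k: "Cod C ?k = A"
    using \<tau>_hom[OF composite_hom[OF c]] by (simp add: hom_def)
  have "nerve_degen C n (j - 1) x = (A, ps @ Idt C (target C A ps) # qs)"
    using nerve_degen_append[of C n ps A qs] by (simp add: x_eq fs ps)
  then have "rotate_simplex (nerve_degen C n (j - 1) x) =
      (t\<^sub>0 (target C A fs), (?k # ps) @ Idt C (target C A ps) # butlast qs)"
    using composite_insert_Idt[of A ps qs] target_insert_Idt[of A ps qs] c qs
    by (simp add: rotate_simplex_def fs butlast_append)
  moreover have "rotate_simplex x = (t\<^sub>0 (target C A fs), (?k # ps) @ butlast qs)"
    using qs by (simp add: x_eq rotate_simplex_def fs butlast_append)
  ultimately show ?thesis
    using nerve_degen_append[of C n "?k # ps" "t\<^sub>0 (target C A fs)" "butlast qs"] j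
    by (simp add: ps k)
qed

text \<open>
  With \<open>c\<close> the composite of the simplex, the second rotation applies \<open>\<tau>\<close> to \<open>c \<cdot> \<tau> c\<close>.  This is
  \<open>\<tau> 1\<close>, so the arrow put in front is \<open>\<tau> (\<tau> 1) = 1\<close>.
\<close>

lemma degen_0_rotate_simplex:
  assumes x: "x \<in> nerve C n"
  shows "nerve_degen C n 0 (rotate_simplex x) =
    rotate_simplex (rotate_simplex (nerve_degen C n n x))"
proof -
  obtain A fs where x_eq: "x = (A, fs)" by (cases x)
  have l: "length fs = n" and c: "composable C A fs"
    using x by (auto simp: x_eq nerve_iff_composable)
  let ?B = "target C A fs"
  let ?c = "composite C A fs"
  have hom_c: "?c \<in> hom C A ?B" by (rule composite_hom[OF c])
  then have B: "?B \<in> Obj C" by (rule hom_Obj)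
  have k: "Cod C (\<tau> ?c) = A" using \<tau>_hom[OF hom_c] by (simp add: hom_def)
  have "nerve_degen C n n x = (A, fs @ [Idt C ?B])"
    using nerve_degen_append[of C n fs A "[]"] l by (simp add: x_eq)
  then have "rotate_simplex (nerve_degen C n n x) = (t\<^sub>0 ?B, \<tau> ?c # fs)"
    using composite_insert_Idt[of A fs "[]"] target_insert_Idt[of A fs "[]"] c
    by (simp add: rotate_simplex_def butlast_append)
  then have "rotate_simplex (rotate_simplex (nerve_degen C n n x)) =
      (t\<^sub>0 ?B, Idt C (t\<^sub>0 ?B) # butlast (\<tau> ?c # fs))"
    using Cmp_\<tau>[OF hom_c] \<tau>_\<tau>_Idt[OF B] k by (simp add: rotate_simplex_def)
  then show ?thesis
    using nerve_degen_append[of C n "[]"] by (simp add: x_eq rotate_simplex_def)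
qed

lemma duplicial_structure_rotate_simplex:
  "duplicial_structure (nerve C) (nerve_face C) (nerve_degen C) (\<lambda>_. rotate_simplex)"
  by (intro duplicial_structure.intro duplicial_structure_axioms.intro simplicial_set_nerve
      rotate_simplex_in_nerve face_rotate_simplex face_0_rotate_simplex
      degen_rotate_simplex degen_0_rotate_simplex)

end

section \<open>The lifting structure of a duplicial structure\<close>

context category
begin

lemma nerve_0: "x \<in> nerve C 0 \<longleftrightarrow> (\<exists>A. x = (A, []) \<and> A \<in> Obj C)"
  by (cases x) (auto simp: nerve_iff_composable)

lemma nerve_1: "x \<in> nerve C (Suc 0) \<longleftrightarrow> (\<exists>f A B. x = (A, [f]) \<and> f \<in> hom C A B)"
  by (cases x) (auto simp: nerve_iff_composable hom_def length_Suc_conv Dom_Obj Cod_Obj)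

lemma nerve_2:
  "x \<in> nerve C (Suc (Suc 0)) \<longleftrightarrow>
    (\<exists>f g A B D. x = (A, [f, g]) \<and> f \<in> hom C A B \<and> g \<in> hom C B D)"
  by (cases x) (auto simp: nerve_iff_composable hom_def length_Suc_conv Dom_Obj Cod_Obj)

lemma lifting_structure_of_duplicial:
  assumes "duplicial_structure (nerve C) (nerve_face C) (nerve_degen C) t"
  shows "\<exists>t\<^sub>0 \<tau>. lifting_structure C t\<^sub>0 \<tau>"
proof -
  interpret duplicial_structure "nerve C" "nerve_face C" "nerve_degen C" t by fact
  define t\<^sub>0 where "t\<^sub>0 A = fst (t 0 (A, []))" for A
  define \<tau> where "\<tau> f = hd (snd (t (Suc 0) (Dom C f, [f])))" for f
  have t_0: "t 0 (A, []) = (t\<^sub>0 A, []) \<and> t\<^sub>0 A \<in> Obj C" if "A \<in> Obj C" for A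
    using t_in[of "(A, [])" 0] that by (auto simp: nerve_0 t\<^sub>0_def)
  have t_1: "t (Suc 0) (A, [f]) = (t\<^sub>0 B, [\<tau> f]) \<and> \<tau> f \<in> hom C (t\<^sub>0 B) A"
    if f: "f \<in> hom C A B" for f A B
  proof -
    have x: "(A, [f]) \<in> nerve C (Suc 0)" using f by (auto simp: nerve_1)
    have AB: "Dom C f = A" "Cod C f = B" "B \<in> Obj C"
      using f Cod_Obj by (auto simp: hom_def)
    obtain k X Y where k: "t (Suc 0) (A, [f]) = (X, [k])" "k \<in> hom C X Y"
      using t_in[OF x] by (auto simp: nerve_1)
    have "\<tau> f = k" using k by (simp add: \<tau>_def AB)
    moreover have "Cod C k = A"
      using face_t_0[OF x] k by (simp add: nerve_face_first nerve_face_last)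
    moreover have "X = t\<^sub>0 B"
      using face_t[OF x, of "Suc 0"] k t_0[OF AB(3)] AB(2)
      by (simp add: nerve_face_first nerve_face_last)
    ultimately show ?thesis using k by (simp add: hom_def)
  qed
  have "f \<cdot> \<tau> (g \<cdot> f) = \<tau> g" if f: "f \<in> hom C A B" and g: "g \<in> hom C B D" for f g A B D
  proof -
    have x: "(A, [f, g]) \<in> nerve C (Suc (Suc 0))" using f g by (auto simp: nerve_2)
    obtain X p q where pq: "t (Suc (Suc 0)) (A, [f, g]) = (X, [p, q])"
      using t_in[OF x] by (auto simp: nerve_2)
    have inner: "nerve_face C (Suc (Suc 0)) (Suc 0) (Y, [h, k]) = (Y, [k \<cdot> h])" for Y h k
      using nerve_face_inner[of "Suc (Suc 0)" "[]" "[]" C Y h k] by simp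
    have "q = f"
      using face_t_0[OF x] pq by (simp add: nerve_face_first nerve_face_last)
    moreover have "q \<cdot> p = \<tau> g"
      using face_t[OF x, of "Suc 0"] pq t_1[OF g] f
      by (simp add: inner nerve_face_first hom_def)
    moreover have "p = \<tau> (g \<cdot> f)"
      using face_t[OF x, of "Suc (Suc 0)"] pq t_1[OF Cmp_hom[OF f g]]
      by (simp add: inner nerve_face_last)
    ultimately show ?thesis by simp
  qed
  moreover have "\<tau> (\<tau> (Idt C A)) = Idt C (t\<^sub>0 A)" if A: "A \<in> Obj C" for A
  proof -
    have degen: "nerve_degen C 0 0 (B, []) = (B, [Idt C B])" for B
      using nerve_degen_append[of C 0 "[]"] by simp
    have "\<tau> (Idt C A) \<in> hom C (t\<^sub>0 A) A" using t_1[OF Idt_hom[OF A]] by simp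
    from t_1[OF this] show ?thesis
      using degen_t_0[of "(A, [])" 0] A t_0[OF A] t_1[OF Idt_hom[OF A]]
      by (simp add: degen nerve_0)
  qed
  ultimately have "lifting_structure C t\<^sub>0 \<tau>"
    using t_0 t_1 category_axioms
    by (intro lifting_structure.intro lifting_structure_axioms.intro) blast+
  then show ?thesis by blast
qed

lemma duplicial_iff_lifting:
  "(\<exists>t. duplicial_structure (nerve C) (nerve_face C) (nerve_degen C) t) \<longleftrightarrow>
    (\<exists>t\<^sub>0 \<tau>. lifting_structure C t\<^sub>0 \<tau>)"
  using lifting_structure_of_duplicial lifting_structure.duplicial_structure_rotate_simplex
  by blast

end

section \<open>The coreflective groupoid of a lifting structure\<close>

definition full_subcategory :: "('o, 'a) cat \<Rightarrow> 'o set \<Rightarrow> ('o, 'a) cat" where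
  "full_subcategory C S =
     C\<lparr>Obj := S, Arr := {f \<in> Arr C. Dom C f \<in> S \<and> Cod C f \<in> S}\<rparr>"

lemma full_subcategory_simps [simp]:
  "Obj (full_subcategory C S) = S"
  "Dom (full_subcategory C S) = Dom C"
  "Cod (full_subcategory C S) = Cod C"
  "Idt (full_subcategory C S) = Idt C"
  "Cmp (full_subcategory C S) = Cmp C"
  by (simp_all add: full_subcategory_def)

lemma hom_full_subcategory:
  "f \<in> hom (full_subcategory C S) A B \<longleftrightarrow> f \<in> hom C A B \<and> A \<in> S \<and> B \<in> S"
  by (auto simp: hom_def full_subcategory_def)

context category
begin

lemma category_full_subcategory:
  assumes "S \<subseteq> Obj C"
  shows "category (full_subcategory C S)"
proof
  fix f assume "f \<in> Arr (full_subcategory C S)"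
  then show "Dom (full_subcategory C S) f \<in> Obj (full_subcategory C S)"
    and "Cod (full_subcategory C S) f \<in> Obj (full_subcategory C S)"
    by (auto simp: full_subcategory_def)
qed (use assms Idt_hom Cmp_hom Cmp_Idt_left Cmp_Idt_right Cmp_assoc
      in \<open>auto simp: hom_full_subcategory\<close>)

end

context lifting_structure
begin

definition counit :: "'o \<Rightarrow> 'a" where
  "counit A = \<tau> (Idt C A)"

lemma counit_hom: "A \<in> Obj C \<Longrightarrow> counit A \<in> hom C (t\<^sub>0 A) A"
  by (simp add: counit_def \<tau>_hom Idt_hom)

text \<open>
  By \<open>\<tau> (\<tau> 1) = 1\<close> the law \<open>f \<cdot> \<tau> (g \<cdot> f) = \<tau> g\<close> for \<open>g = counit A\<close> has an identity on its
  right-hand side.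
\<close>

lemma split_epi:
  assumes A: "A \<in> Obj C" and f: "f \<in> hom C X (t\<^sub>0 A)"
  shows "\<tau> (counit A \<cdot> f) \<in> hom C (t\<^sub>0 A) X" "f \<cdot> \<tau> (counit A \<cdot> f) = Idt C (t\<^sub>0 A)"
  using \<tau>_hom[OF Cmp_hom[OF f counit_hom[OF A]]] \<tau>_Cmp[OF f counit_hom[OF A]] \<tau>_\<tau>_Idt[OF A]
  by (simp_all add: counit_def)

lemma iso_between_images:
  assumes A: "A \<in> Obj C" and B: "B \<in> Obj C" and f: "f \<in> hom C (t\<^sub>0 A) (t\<^sub>0 B)"
  shows "\<exists>g \<in> hom C (t\<^sub>0 B) (t\<^sub>0 A). g \<cdot> f = Idt C (t\<^sub>0 A) \<and> f \<cdot> g = Idt C (t\<^sub>0 B)"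
proof -
  \<comment> \<open>A section \<open>g\<close> of \<open>f\<close> has a section \<open>h\<close>, and \<open>h = f \<cdot> g \<cdot> h = f\<close>.\<close>
  obtain g where g: "g \<in> hom C (t\<^sub>0 B) (t\<^sub>0 A)" "f \<cdot> g = Idt C (t\<^sub>0 B)"
    using split_epi[OF B f] by blast
  obtain h where h: "h \<in> hom C (t\<^sub>0 A) (t\<^sub>0 B)" "g \<cdot> h = Idt C (t\<^sub>0 A)"
    using split_epi[OF A g(1)] by blast
  have "h = f"
    using Cmp_assoc[OF h(1) g(1) f] Cmp_Idt_left[OF h(1)] Cmp_Idt_right[OF f] g h by simp
  then show ?thesis using g h by blast
qed

abbreviation image_groupoid :: "('o, 'a) cat" where
  "image_groupoid \<equiv> full_subcategory C (t\<^sub>0 ` Obj C)"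

lemma groupoid_image: "groupoid image_groupoid"
proof (intro groupoid.intro groupoid_axioms.intro)
  show "category image_groupoid"
    using t\<^sub>0_Obj by (intro category_full_subcategory) auto
next
  fix f A B assume "f \<in> hom image_groupoid A B"
  then show "\<exists>g \<in> hom image_groupoid B A.
      g \<cdot>\<^bsub>image_groupoid\<^esub> f = Idt image_groupoid A \<and>
      f \<cdot>\<^bsub>image_groupoid\<^esub> g = Idt image_groupoid B"
    using iso_between_images[of _ _ f] unfolding hom_full_subcategory Bex_def by auto
qed

lemma \<tau>_\<tau>_hom: "f \<in> hom C A B \<Longrightarrow> \<tau> (\<tau> f) \<in> hom C (t\<^sub>0 A) (t\<^sub>0 B)"
  by (intro \<tau>_hom)

lemma \<tau>_\<tau>_Cmp:
  assumes f: "f \<in> hom C A B" and g: "g \<in> hom C B D"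
  shows "\<tau> (\<tau> (g \<cdot> f)) = \<tau> (\<tau> g) \<cdot> \<tau> (\<tau> f)"
proof -
  have gf: "\<tau> (g \<cdot> f) \<in> hom C (t\<^sub>0 D) A" by (intro \<tau>_hom Cmp_hom[OF f g])
  have "\<tau> f = \<tau> (g \<cdot> f) \<cdot> \<tau> (\<tau> g)"
    using \<tau>_Cmp[OF gf f] \<tau>_Cmp[OF f g] by simp
  then show ?thesis
    using \<tau>_Cmp[OF \<tau>_\<tau>_hom[OF g] gf] by simp
qed

lemma counit_natural:
  assumes f: "f \<in> hom C A B"
  shows "f \<cdot> counit A = counit B \<cdot> \<tau> (\<tau> f)"
proof -
  have \<tau>f: "\<tau> f \<in> hom C (t\<^sub>0 B) A" by (rule \<tau>_hom[OF f])
  show ?thesis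
    using Cmp_\<tau>[OF f] Cmp_\<tau>[OF \<tau>f] Cmp_assoc[OF \<tau>_hom[OF \<tau>f] \<tau>f f]
    by (simp add: counit_def)
qed

lemma adjunction_image:
  "\<exists>(G :: ('o, 'a) cat) I R. groupoid G \<and> left_adjoint G C I R"
proof -
  let ?G = image_groupoid
  let ?I = "\<lparr>omap = \<lambda>X. X, amap = \<lambda>f. f\<rparr>"
  let ?R = "\<lparr>omap = t\<^sub>0, amap = \<lambda>f. \<tau> (\<tau> f)\<rparr>"
  interpret G: groupoid ?G by (rule groupoid_image)
  have "\<forall>X \<in> t\<^sub>0 ` Obj C. \<exists>g. g \<in> hom C X (t\<^sub>0 X) \<and>
      g \<cdot> counit X = Idt C (t\<^sub>0 X) \<and> counit X \<cdot> g = Idt C X"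
  proof
    fix X assume "X \<in> t\<^sub>0 ` Obj C"
    then obtain A where A: "A \<in> Obj C" and X: "X = t\<^sub>0 A" by blast
    then show "\<exists>g. g \<in> hom C X (t\<^sub>0 X) \<and>
        g \<cdot> counit X = Idt C (t\<^sub>0 X) \<and> counit X \<cdot> g = Idt C X"
      using iso_between_images[OF t\<^sub>0_Obj[OF A] A] counit_hom[OF t\<^sub>0_Obj[OF A]] by blast
  qed
  then obtain \<eta> where \<eta>: "\<And>X. X \<in> t\<^sub>0 ` Obj C \<Longrightarrow> \<eta> X \<in> hom C X (t\<^sub>0 X) \<and>
      \<eta> X \<cdot> counit X = Idt C (t\<^sub>0 X) \<and> counit X \<cdot> \<eta> X = Idt C X"
    by metis
  have Obj: "X \<in> Obj C" if "X \<in> t\<^sub>0 ` Obj C" for X using that t\<^sub>0_Obj by auto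
  have natural: "\<tau> (\<tau> u) \<cdot> \<eta> X = \<eta> Y \<cdot> u"
    if u: "u \<in> hom C X Y" and X: "X \<in> t\<^sub>0 ` Obj C" and Y: "Y \<in> t\<^sub>0 ` Obj C" for u X Y
  proof -
    have \<eta>X: "\<eta> X \<in> hom C X (t\<^sub>0 X)" "counit X \<cdot> \<eta> X = Idt C X"
      and \<eta>Y: "\<eta> Y \<in> hom C Y (t\<^sub>0 Y)" "\<eta> Y \<cdot> counit Y = Idt C (t\<^sub>0 Y)"
      using \<eta>[OF X] \<eta>[OF Y] by auto
    note \<epsilon>X = counit_hom[OF Obj[OF X]] and \<epsilon>Y = counit_hom[OF Obj[OF Y]]
    note Tu = \<tau>_\<tau>_hom[OF u]
    note Tu_\<eta>X = Cmp_hom[OF \<eta>X(1) Tu]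
    have "\<tau> (\<tau> u) \<cdot> \<eta> X = (\<eta> Y \<cdot> counit Y) \<cdot> (\<tau> (\<tau> u) \<cdot> \<eta> X)"
      using Cmp_Idt_left[OF Tu_\<eta>X] \<eta>Y by simp
    also have "\<dots> = \<eta> Y \<cdot> ((counit Y \<cdot> \<tau> (\<tau> u)) \<cdot> \<eta> X)"
      using Cmp_assoc[OF Tu_\<eta>X \<epsilon>Y \<eta>Y(1)] Cmp_assoc[OF \<eta>X(1) Tu \<epsilon>Y] by simp
    also have "\<dots> = \<eta> Y \<cdot> (u \<cdot> (counit X \<cdot> \<eta> X))"
      using counit_natural[OF u] Cmp_assoc[OF \<eta>X(1) \<epsilon>X u] by simp
    also have "\<dots> = \<eta> Y \<cdot> u"
      using \<eta>X Cmp_Idt_right[OF u] by simp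
    finally show ?thesis .
  qed
  have "adjunction ?G C ?I ?R \<eta> counit"
  proof (intro adjunction.intro adjunction_axioms.intro cat_functor.intro
      cat_functor_axioms.intro G.category_axioms category_axioms)
    fix A assume "A \<in> Obj C"
    then show "amap ?R (counit A) \<cdot>\<^bsub>?G\<^esub> \<eta> (omap ?R A) = Idt ?G (omap ?R A)"
      using \<eta>[of "t\<^sub>0 A"] by (simp add: counit_def \<tau>_\<tau>_Idt)
  qed (use \<eta> Obj natural hom_Obj t\<^sub>0_Obj \<tau>_\<tau>_hom \<tau>_\<tau>_Cmp \<tau>_\<tau>_Idt counit_hom counit_natural
      in \<open>auto simp: hom_full_subcategory\<close>)
  then show ?thesis
    using groupoid_image unfolding left_adjoint_def by blast
qed

end

section \<open>The lifting structure of an adjunction with a groupoid\<close>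

lemma (in adjunction) lifting_structure_groupoid:
  assumes "groupoid G"
  shows "\<exists>t\<^sub>0 \<tau>. lifting_structure C t\<^sub>0 \<tau>"
proof -
  interpret G: groupoid G by fact
  \<comment> \<open>\<open>v f\<close> will be the inverse of \<open>R f\<close>.\<close>
  have "\<forall>f \<in> Arr C. \<exists>v. v \<in> hom G (omap R (Cod C f)) (omap R (Dom C f)) \<and>
      v \<cdot>\<^bsub>G\<^esub> amap R f = Idt G (omap R (Dom C f)) \<and>
      amap R f \<cdot>\<^bsub>G\<^esub> v = Idt G (omap R (Cod C f))"
  proof
    fix f assume "f \<in> Arr C"
    then have "f \<in> hom C (Dom C f) (Cod C f)" by (simp add: hom_def)
    from G.invertible[OF right.amap_hom[OF this]]
    show "\<exists>v. v \<in> hom G (omap R (Cod C f)) (omap R (Dom C f)) \<and>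
      v \<cdot>\<^bsub>G\<^esub> amap R f = Idt G (omap R (Dom C f)) \<and>
      amap R f \<cdot>\<^bsub>G\<^esub> v = Idt G (omap R (Cod C f))" by blast
  qed
  then obtain v where "\<And>f. f \<in> Arr C \<Longrightarrow> v f \<in> hom G (omap R (Cod C f)) (omap R (Dom C f)) \<and>
      v f \<cdot>\<^bsub>G\<^esub> amap R f = Idt G (omap R (Dom C f)) \<and>
      amap R f \<cdot>\<^bsub>G\<^esub> v f = Idt G (omap R (Cod C f))"
    by metis
  then have v_hom: "v f \<in> hom G (omap R B) (omap R A)"
    and v_left: "v f \<cdot>\<^bsub>G\<^esub> amap R f = Idt G (omap R A)"
    and v_right: "amap R f \<cdot>\<^bsub>G\<^esub> v f = Idt G (omap R B)"
    if "f \<in> hom C A B" for f A B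
    using that by (auto simp: hom_def)
  have v_unique: "w = v f"
    if f: "f \<in> hom C A B" and w: "w \<in> hom G (omap R B) (omap R A)"
      and eq: "amap R f \<cdot>\<^bsub>G\<^esub> w = Idt G (omap R B)" for f w A B
    using left.source.Cmp_assoc[OF w right.amap_hom[OF f] v_hom[OF f]] v_left[OF f] eq
      left.source.Cmp_Idt_left[OF w] left.source.Cmp_Idt_right[OF v_hom[OF f]] by simp
  define \<tau> where "\<tau> f = \<epsilon> (Dom C f) \<cdot>\<^bsub>C\<^esub> amap L (v f)" for f
  have \<tau>: "\<tau> f = \<epsilon> A \<cdot>\<^bsub>C\<^esub> amap L (v f)" if "f \<in> hom C A B" for f A B
    using that by (simp add: \<tau>_def hom_def)
  have "lifting_structure C (\<lambda>A. omap L (omap R A)) \<tau>"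
  proof (intro lifting_structure.intro lifting_structure_axioms.intro)
    show "category C" by (rule left.target.category_axioms)
    show "omap L (omap R A) \<in> Obj C" if "A \<in> Obj C" for A
      using that by (intro left.omap_Obj right.omap_Obj)
    show "\<tau> f \<in> hom C (omap L (omap R B)) A" if f: "f \<in> hom C A B" for f A B
      unfolding \<tau>[OF f] using left.target.hom_Obj[OF f]
      by (intro left.target.Cmp_hom[OF left.amap_hom[OF v_hom[OF f]]] counit_hom) simp
  next
    fix f g A B D assume f: "f \<in> hom C A B" and g: "g \<in> hom C B D"
    have gf: "g \<cdot>\<^bsub>C\<^esub> f \<in> hom C A D" by (rule left.target.Cmp_hom[OF f g])
    note \<epsilon>A = counit_hom[of A] and \<epsilon>B = counit_hom[of B]
    note Rf = right.amap_hom[OF f]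
    have "amap R f \<cdot>\<^bsub>G\<^esub> v (g \<cdot>\<^bsub>C\<^esub> f) = v g"
    proof (rule v_unique[OF g])
      show "amap R f \<cdot>\<^bsub>G\<^esub> v (g \<cdot>\<^bsub>C\<^esub> f) \<in> hom G (omap R D) (omap R B)"
        by (rule left.source.Cmp_hom[OF v_hom[OF gf] Rf])
      show "amap R g \<cdot>\<^bsub>G\<^esub> (amap R f \<cdot>\<^bsub>G\<^esub> v (g \<cdot>\<^bsub>C\<^esub> f)) = Idt G (omap R D)"
        using left.source.Cmp_assoc[OF v_hom[OF gf] Rf right.amap_hom[OF g]] v_right[OF gf]
          right.amap_Cmp[OF f g] by simp
    qed
    then have "amap L (v g) = amap L (amap R f) \<cdot>\<^bsub>C\<^esub> amap L (v (g \<cdot>\<^bsub>C\<^esub> f))"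
      using left.amap_Cmp[OF v_hom[OF gf] Rf] by simp
    then show "f \<cdot>\<^bsub>C\<^esub> \<tau> (g \<cdot>\<^bsub>C\<^esub> f) = \<tau> g"
      using left.target.Cmp_assoc[OF left.amap_hom[OF v_hom[OF gf]] \<epsilon>A f]
        left.target.Cmp_assoc[OF left.amap_hom[OF v_hom[OF gf]] left.amap_hom[OF Rf] \<epsilon>B]
        counit_natural[OF f] left.target.hom_Obj[OF f] by (simp add: \<tau>[OF gf] \<tau>[OF g])
  next
    fix A assume A: "A \<in> Obj C"
    let ?X = "omap R A"
    have X: "?X \<in> Obj G" by (rule right.omap_Obj[OF A])
    note Id = left.target.Idt_hom[OF A] and \<epsilon>A = counit_hom[OF A]
    have "v (Idt C A) = Idt G ?X"
      using v_unique[OF Id left.source.Idt_hom[OF X]] right.amap_Idt[OF A]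
        left.source.Cmp_Idt_left[OF left.source.Idt_hom[OF X]]
      by simp
    then have "\<tau> (Idt C A) = \<epsilon> A"
      using \<tau>[OF Id] left.amap_Idt[OF X] left.target.Cmp_Idt_right[OF \<epsilon>A] by simp
    \<comment> \<open>The inverse of \<open>R \<epsilon>\<^sub>A\<close> is the unit, so the other triangle identity applies.\<close>
    moreover have "v (\<epsilon> A) = \<eta> ?X"
      using v_unique[OF \<epsilon>A unit_hom[OF X] triangle_right[OF A]] by simp
    ultimately show "\<tau> (\<tau> (Idt C A)) = Idt C (omap L ?X)"
      using \<tau>[OF \<epsilon>A] triangle_left[OF X] by simp
  qed
  then show ?thesis by blast
qed

lemma (in category) lifting_structure_of_left_adjoint:
  assumes "groupoid G" "left_adjoint G C L R"
  shows "\<exists>t\<^sub>0 \<tau>. lifting_structure C t\<^sub>0 \<tau>"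
  using assms adjunction.lifting_structure_groupoid unfolding left_adjoint_def by blast

theorem theorem5p3p13:
  fixes C :: "('o, 'a) cat"
  assumes "category C"
  shows "((\<exists>t. duplicial_structure (nerve C) (nerve_face C) (nerve_degen C) t) \<longleftrightarrow>
          (\<exists>(G :: ('o, 'a) cat) I R. groupoid G \<and> left_adjoint G C I R)) \<and>
         (\<forall>(G :: ('p, 'b) cat) I R. groupoid G \<and> left_adjoint G C I R \<longrightarrow>
          (\<exists>t. duplicial_structure (nerve C) (nerve_face C) (nerve_degen C) t))"
proof -
  interpret category C by fact
  show ?thesis
    unfolding duplicial_iff_lifting
  proof (intro conjI iffI allI impI)
    assume "\<exists>t\<^sub>0 \<tau>. lifting_structure C t\<^sub>0 \<tau>"
    then show "\<exists>(G :: ('o, 'a) cat) I R. groupoid G \<and> left_adjoint G C I R"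
      using lifting_structure.adjunction_image by blast
  qed (auto intro: lifting_structure_of_left_adjoint)
qed

end
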